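(* Let $G$ be a group which is isomorphic to the direct limit of a sequence of groups and homomorphisms $\{\phi_i\colon G_i\to G_{i+1}\mid i\in\mathbb{N}\}$, where each $G_i$ is countable and hyperbolic relative to some collection $\mathcal{P}_i$ of proper subgroups of $G_i$. Then for every $i$ there exist a finite relative presentation $Pres_i$ of $G_i$ with respect to $\mathcal{P}_i$ and a homomorphism $\phi_i'\colon G_i'\to G_{i+1}'$, where $G_i'$ denotes the finitely generated core of $G_i$ associated to $Pres_i$ for each $i$, such that $G$ is isomorphic to the direct limit of the sequence of finitely generated groups $\{\phi_i'\colon G_i'\to G_{i+1}'\mid i\in\mathbb{N}\}$.
   Context: Direct limit: given groups $\{G_i\}_{i\in\mathbb{N}}$ and homomorphisms $\phi_i\colon G_i\to G_{i+1}$, let $\Lambda\subset\prod_{i}G_i$ be the set of sequences $(g_i)$ for which there is $J$ with $g_{j+1}=\phi_j(g_j)$ for all $j\ge J$. Put $(g_i)\sim(h_i)$ if there is $K$ with $g_k=h_k$ for all $k\ge K$. The direct limit is the group $\Lambda/\!\sim$ with operation induced by the componentwise product. Finite relative presentation: let $G$ be a group with a family of subgroups $\{H_\lambda\}_{\lambda\in\Lambda}$ (both the index set $\Lambda$ and the groups $H_\lambda$ may be infinite and the $H_\lambda$ need not be finitely generated). Let $S$ be a finite subset of $G$, let $\mathcal{F}(S)$ be the free group on $S$, and let $\mathcal{R}$ be a finite subset of $\mathcal{F}(S)*( *_{\lambda\in\Lambda}H_\lambda)$. Let $\mathcal{H}$ be the disjoint union of the $H_\lambda$, for each $\lambda$ let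 $\mathcal{R}_\lambda$ be the set of words in the alphabet $H_\lambda$ which represent the identity in $H_\lambda$, and let $\mathcal{R}_\Lambda=\bigcup_\lambda\mathcal{R}_\lambda$. One writes $G=\langle S,\{H_\lambda\}_{\lambda\in\Lambda}\mid\mathcal{R}\rangle$, a finite relative presentation of $G$ with respect to $\{H_\lambda\}$, if $G=\langle S\cup\mathcal{H}\mid\mathcal{R}\cup\mathcal{R}_\Lambda\rangle$ is an ordinary presentation of $G$ (generators mapping to the corresponding elements of $G$). Relative hyperbolicity: the relative area of a van Kampen diagram over $\langle S\cup\mathcal{H}\mid\mathcal{R}\cup\mathcal{R}_\Lambda\rangle$ is its number of $2$-cells labelled by elements of $\mathcal{R}$. A group $G$ with finite relative presentation $\langle S,\{H_\lambda\}\mid\mathcal{R}\rangle$ is hyperbolic relative to $\{H_\lambda\}_{\lambda\in\Lambda}$ if there is a constant $C$ so that every word $w$ of length $n$ in the alphabet $S\cup\mathcal{H}$ which represents the identity in $G$ is the boundary label of a van Kampen diagram of relative area at most $Cn$. Finitely generated core: given a finite relative presentation $G=\langle S,\{H_\lambda\}_{\lambda\in\Lambda}\mid\mathcal{R}\rangle$, write each $r\in\mathcal{R}$ in normal form $r=w_1h_1\cdots w_nh_n$ with each $w_i$ a word in $\mathcal{F}(S)$ and each $h_i\in H_{\lambda_i}$ for some $\lambda_i\in\Lambda$. Let $\Omega$ be the (finite) set of nontrivial elements of $\bigcup_\lambda H_\lambda$ which occur in one of these normal forms, let $I=\{\lambda\in\Lambda\mid H_\lambda\cap\Omega\neq\emptyset\}$,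 and for $i\in I$ let $H_i'$ be the subgroup of $H_i$ generated by $\Omega\cap H_i$. The subgroup $G'$ of $G$ generated by $S\cup\bigcup_{i\in I}H_i'$ is the finitely generated core of $G$ associated to the presentation $\langle S,\{H_\lambda\}_{\lambda\in\Lambda}\mid\mathcal{R}\rangle$. *)

theory Defs
  imports "HOL-Algebra.Product_Groups" "HOL-Algebra.Generated_Groups" "HOL-Combinatorics.Orbits" "HOL-Library.Countable_Set" Complex_Main
begin

section \<open>Direct limits of sequences of groups\<close>

definition limit_seqs :: "(nat \<Rightarrow> 'a monoid) \<Rightarrow> (nat \<Rightarrow> 'a \<Rightarrow> 'a) \<Rightarrow> (nat \<Rightarrow> 'a) set" where
  "limit_seqs Gs \<phi> =
     {g \<in> carrier (product_group UNIV Gs). \<exists>J. \<forall>j\<ge>J. g (Suc j) = \<phi> j (g j)}"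

definition limit_rel :: "(nat \<Rightarrow> 'a monoid) \<Rightarrow> (nat \<Rightarrow> 'a \<Rightarrow> 'a) \<Rightarrow> (nat \<Rightarrow> 'a) rel" where
  "limit_rel Gs \<phi> =
     {(g, h). g \<in> limit_seqs Gs \<phi> \<and> h \<in> limit_seqs Gs \<phi> \<and> (\<exists>K. \<forall>k\<ge>K. g k = h k)}"

definition direct_limit :: "(nat \<Rightarrow> 'a monoid) \<Rightarrow> (nat \<Rightarrow> 'a \<Rightarrow> 'a) \<Rightarrow> (nat \<Rightarrow> 'a) set monoid" where
  "direct_limit Gs \<phi> =
     \<lparr>carrier = limit_seqs Gs \<phi> // limit_rel Gs \<phi>,
      monoid.mult = (\<lambda>A B. \<Union>g\<in>A. \<Union>h\<in>B. limit_rel Gs \<phi> `` {g \<otimes>\<^bsub>product_group UNIV Gs\<^esub> h}),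
      one = limit_rel Gs \<phi> `` {\<one>\<^bsub>product_group UNIV Gs\<^esub>}\<rparr>"


section \<open>Group presentations\<close>

text \<open>The letter \<open>(x, True)\<close> stands for the generator \<open>x\<close>, and \<open>(x, False)\<close> for its formal inverse.\<close>

type_synonym 'x word = "('x \<times> bool) list"

definition words :: "'x set \<Rightarrow> 'x word set" where
  "words X = lists (X \<times> UNIV)"

definition inv_letter :: "'x \<times> bool \<Rightarrow> 'x \<times> bool" where
  "inv_letter p = (fst p, \<not> snd p)"

definition inv_word :: "'x word \<Rightarrow> 'x word" where
  "inv_word w = rev (map inv_letter w)"

inductive_set word_eq :: "'x set \<Rightarrow> 'x word set \<Rightarrow> 'x word rel" for X Q where
  refl: "u \<in> words X \<Longrightarrow> (u, u) \<in> word_eq X Q"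
| sym: "(u, v) \<in> word_eq X Q \<Longrightarrow> (v, u) \<in> word_eq X Q"
| trans: "(u, v) \<in> word_eq X Q \<Longrightarrow> (v, w) \<in> word_eq X Q \<Longrightarrow> (u, w) \<in> word_eq X Q"
| cancel: "u \<in> words X \<Longrightarrow> v \<in> words X \<Longrightarrow> p \<in> X \<times> UNIV \<Longrightarrow>
     (u @ [p, inv_letter p] @ v, u @ v) \<in> word_eq X Q"
| relator: "u \<in> words X \<Longrightarrow> v \<in> words X \<Longrightarrow> q \<in> Q \<Longrightarrow> q \<in> words X \<Longrightarrow>
     (u @ q @ v, u @ v) \<in> word_eq X Q"

text \<open>The group \<open>\<langle>X | Q\<rangle>\<close>.\<close>

definition presented_group :: "'x set \<Rightarrow> 'x word set \<Rightarrow> 'x word set monoid" where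
  "presented_group X Q =
     \<lparr>carrier = words X // word_eq X Q,
      monoid.mult = (\<lambda>A B. \<Union>u\<in>A. \<Union>v\<in>B. word_eq X Q `` {u @ v}),
      one = word_eq X Q `` {[]}\<rparr>"

text \<open>\<open>\<langle>X | Q\<rangle>\<close> is a presentation of \<open>G\<close> in which the generator \<open>x\<close> maps to \<open>val x\<close>.\<close>

definition is_presentation :: "'a monoid \<Rightarrow> ('x \<Rightarrow> 'a) \<Rightarrow> 'x set \<Rightarrow> 'x word set \<Rightarrow> bool" where
  "is_presentation G val X Q \<longleftrightarrow>
     Q \<subseteq> words X \<and>
     (\<exists>f \<in> iso (presented_group X Q) G. \<forall>x\<in>X. f (word_eq X Q `` {[(x, True)]}) = val x)"

definition word_value :: "'a monoid \<Rightarrow> ('x \<Rightarrow> 'a) \<Rightarrow> 'x word \<Rightarrow> 'a" where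
  "word_value G val w =
     foldr (\<lambda>(x, b) g. (if b then val x else inv\<^bsub>G\<^esub> val x) \<otimes>\<^bsub>G\<^esub> g) w \<one>\<^bsub>G\<^esub>"


section \<open>Van Kampen diagrams\<close>

text \<open>A van Kampen diagram (a finite connected simply connected planar 2-complex) is encoded, together
  with the complementary outer region, as a combinatorial map on the sphere. Darts are oriented
  edges, \<open>flip\<close> reverses a dart, and \<open>succ\<close> sends a dart to its successor along the boundary of the
  face on a fixed side of it. Faces are the orbits of \<open>succ\<close>. The dart \<open>succ (flip d)\<close> has the same
  initial vertex as \<open>d\<close>, and vertices are the orbits of \<open>succ \<circ> flip\<close>. By connectedness, planarity
  means Euler characteristic 2. The face containing the dart \<open>base\<close> is the outer region, and the
  other faces are the 2-cells. The diagram consisting of a single vertex has no darts.\<close>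

record 'x diagram =
  darts :: "nat set"
  flip :: "nat \<Rightarrow> nat"
  succ :: "nat \<Rightarrow> nat"
  label :: "nat \<Rightarrow> 'x \<times> bool"
  base :: nat

definition edges :: "'x diagram \<Rightarrow> nat set set" where
  "edges D = (\<lambda>d. {d, flip D d}) ` darts D"

definition vertices :: "'x diagram \<Rightarrow> nat set set" where
  "vertices D = orbit (succ D \<circ> flip D) ` darts D"

definition faces :: "'x diagram \<Rightarrow> nat set set" where
  "faces D = orbit (succ D) ` darts D"

definition cells :: "'x diagram \<Rightarrow> nat set set" where
  "cells D = faces D - {orbit (succ D) (base D)}"

definition planar_map :: "'x diagram \<Rightarrow> bool" where
  "planar_map D \<longleftrightarrow>
     finite (darts D) \<and>
     flip D permutes darts D \<and> (\<forall>d\<in>darts D. flip D d \<noteq> d \<and> flip D (flip D d) = d) \<and>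
     succ D permutes darts D \<and>
     (darts D \<noteq> {} \<longrightarrow>
        base D \<in> darts D \<and>
        (\<forall>d\<in>darts D. \<forall>e\<in>darts D. (d, e) \<in> {(x, y). y = flip D x \<or> y = succ D x}\<^sup>*) \<and>
        card (vertices D) + card (faces D) = card (edges D) + 2)"

text \<open>The label of the face containing \<open>d\<close>, read once around starting with \<open>d\<close>.\<close>

definition face_word :: "'x diagram \<Rightarrow> nat \<Rightarrow> 'x word" where
  "face_word D d = map (\<lambda>k. label D ((succ D ^^ k) d)) [0..<card (orbit (succ D) d)]"

definition boundary_label :: "'x diagram \<Rightarrow> 'x word" where
  "boundary_label D = (if darts D = {} then [] else face_word D (base D))"

text \<open>A cell is labelled by a relator if the relator or its inverse is read around the cell from some
  starting point.\<close>

definition cell_labelled_by :: "'x diagram \<Rightarrow> 'x word set \<Rightarrow> nat set \<Rightarrow> bool" where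
  "cell_labelled_by D Q c \<longleftrightarrow> (\<exists>d\<in>c. face_word D d \<in> Q \<or> inv_word (face_word D d) \<in> Q)"

definition van_kampen_diagram :: "'x set \<Rightarrow> 'x word set \<Rightarrow> 'x diagram \<Rightarrow> bool" where
  "van_kampen_diagram X Q D \<longleftrightarrow>
     planar_map D \<and>
     (\<forall>d\<in>darts D. label D d \<in> X \<times> UNIV \<and> label D (flip D d) = inv_letter (label D d)) \<and>
     (\<forall>c\<in>cells D. cell_labelled_by D Q c)"


section \<open>Finite relative presentations and relative hyperbolicity\<close>

text \<open>A family of subgroups is given by an index set \<open>\<Lambda>\<close> and a function \<open>H\<close>. The alphabet is the disjoint
  union of \<open>S\<close> and all \<open>H l\<close>, so one element of the group may occur as several different letters.\<close>

type_synonym ('a, 'l) rel_gen = "'a + 'l \<times> 'a"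

definition rel_gens :: "'l set \<Rightarrow> ('l \<Rightarrow> 'a set) \<Rightarrow> 'a set \<Rightarrow> ('a, 'l) rel_gen set" where
  "rel_gens \<Lambda> H S = Inl ` S \<union> Inr ` Sigma \<Lambda> H"

definition rel_val :: "('a, 'l) rel_gen \<Rightarrow> 'a" where
  "rel_val = case_sum (\<lambda>s. s) snd"

definition peripheral_relators ::
    "'a monoid \<Rightarrow> 'l set \<Rightarrow> ('l \<Rightarrow> 'a set) \<Rightarrow> ('a, 'l) rel_gen word set" where
  "peripheral_relators G \<Lambda> H =
     (\<Union>l\<in>\<Lambda>. {w \<in> words (Inr ` ({l} \<times> H l)). word_value G rel_val w = \<one>\<^bsub>G\<^esub>})"

fun adjacent_ok :: "('a, 'l) rel_gen \<times> bool \<Rightarrow> ('a, 'l) rel_gen \<times> bool \<Rightarrow> bool" where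
  "adjacent_ok (Inl s, b) (Inl t, c) \<longleftrightarrow> \<not> (s = t \<and> b \<noteq> c)"
| "adjacent_ok (Inr (l, h), b) (Inr (m, k), c) \<longleftrightarrow> l \<noteq> m"
| "adjacent_ok p q \<longleftrightarrow> True"

text \<open>The elements of the free product of the free group on \<open>S\<close> and all \<open>H l\<close>, each written as its
  unique normal form: maximal subwords in \<open>S\<close> are freely reduced, the syllables from the \<open>H l\<close> are
  single nontrivial elements, and adjacent syllables lie in different free factors.\<close>

definition free_product_elems ::
    "'a monoid \<Rightarrow> 'l set \<Rightarrow> ('l \<Rightarrow> 'a set) \<Rightarrow> 'a set \<Rightarrow> ('a, 'l) rel_gen word set" where
  "free_product_elems G \<Lambda> H S =
     {w \<in> words (rel_gens \<Lambda> H S).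
        (\<forall>l h b. (Inr (l, h), b) \<in> set w \<longrightarrow> b \<and> h \<noteq> \<one>\<^bsub>G\<^esub>) \<and> successively adjacent_ok w}"

definition finite_rel_presentation ::
    "'a monoid \<Rightarrow> 'l set \<Rightarrow> ('l \<Rightarrow> 'a set) \<Rightarrow> 'a set \<Rightarrow> ('a, 'l) rel_gen word set \<Rightarrow> bool" where
  "finite_rel_presentation G \<Lambda> H S R \<longleftrightarrow>
     finite S \<and> S \<subseteq> carrier G \<and> finite R \<and> R \<subseteq> free_product_elems G \<Lambda> H S \<and>
     is_presentation G rel_val (rel_gens \<Lambda> H S) (R \<union> peripheral_relators G \<Lambda> H)"

definition relative_area :: "'x word set \<Rightarrow> 'x diagram \<Rightarrow> nat" where
  "relative_area R D = card {c \<in> cells D. cell_labelled_by D R c}"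

definition rel_hyperbolic :: "'a monoid \<Rightarrow> 'l set \<Rightarrow> ('l \<Rightarrow> 'a set) \<Rightarrow> bool" where
  "rel_hyperbolic G \<Lambda> H \<longleftrightarrow>
     (\<exists>S R. finite_rel_presentation G \<Lambda> H S R \<and>
        (\<exists>C::real. \<forall>w \<in> words (rel_gens \<Lambda> H S). word_value G rel_val w = \<one>\<^bsub>G\<^esub> \<longrightarrow>
           (\<exists>D. van_kampen_diagram (rel_gens \<Lambda> H S) (R \<union> peripheral_relators G \<Lambda> H) D \<and>
                boundary_label D = w \<and> real (relative_area R D) \<le> C * real (length w))))"


section \<open>The finitely generated core\<close>

definition core_omega :: "'a monoid \<Rightarrow> ('a, 'l) rel_gen word set \<Rightarrow> 'a set" where
  "core_omega G R = {h. h \<noteq> \<one>\<^bsub>G\<^esub> \<and> (\<exists>r\<in>R. \<exists>l b. (Inr (l, h), b) \<in> set r)}"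

definition core_index ::
    "'a monoid \<Rightarrow> 'l set \<Rightarrow> ('l \<Rightarrow> 'a set) \<Rightarrow> ('a, 'l) rel_gen word set \<Rightarrow> 'l set" where
  "core_index G \<Lambda> H R = {l\<in>\<Lambda>. H l \<inter> core_omega G R \<noteq> {}}"

definition core_subgroup ::
    "'a monoid \<Rightarrow> ('l \<Rightarrow> 'a set) \<Rightarrow> ('a, 'l) rel_gen word set \<Rightarrow> 'l \<Rightarrow> 'a set" where
  "core_subgroup G H R i = generate G (core_omega G R \<inter> H i)"

definition fg_core ::
    "'a monoid \<Rightarrow> 'l set \<Rightarrow> ('l \<Rightarrow> 'a set) \<Rightarrow> 'a set \<Rightarrow> ('a, 'l) rel_gen word set \<Rightarrow> 'a monoid" where
  "fg_core G \<Lambda> H S R =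
     G\<lparr>carrier := generate G (S \<union> (\<Union>i\<in>core_index G \<Lambda> H R. core_subgroup G H R i))\<rparr>"

definition finitely_generated :: "'a monoid \<Rightarrow> bool" where
  "finitely_generated G \<longleftrightarrow> (\<exists>A. finite A \<and> A \<subseteq> carrier G \<and> generate G A = carrier G)"

end

theory Submission
  imports Defs
begin

text \<open>
  The generating set of a finite relative presentation can be enlarged by any finite set of elements
  of the group: each new generator \<open>t\<close> comes with a relator \<open>t\<inverse>w\<close>, where \<open>w\<close> is a normal form of \<open>t\<close>
  in the old generators (\<open>finite_rel_presentation_add_generators\<close>). The core of the new presentation
  contains the new generators, so a group has finitely generated cores that contain any prescribed
  finite set.

  This freedom is used along the sequence. The presentation of \<open>G\<^sub>i\<^sub>+\<^sub>1\<close> is chosen after that of \<open>G\<^sub>i\<close>, and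
  its core is made to contain the images under \<open>\<phi>\<^sub>i\<close> of the finitely many generators of the core of \<open>G\<^sub>i\<close>.
  Then \<open>\<phi>\<^sub>i\<close> maps core to core, and \<open>\<phi>'\<^sub>i\<close> can be its restriction. Because the groups are countable,
  their elements can be enumerated, and the core of \<open>G\<^sub>i\<close> can also be made to contain the images in \<open>G\<^sub>i\<close>
  of the first \<open>i + 1\<close> terms of the enumerations of \<open>G\<^sub>0, \<dots>, G\<^sub>i\<close>. So every element of every group eventually
  lands in the cores, and a sequence that is eventually compatible with \<open>\<phi>\<close> eventually consists of
  elements of the cores. Since the limit only sees the tails of sequences, the cores have the same
  direct limit as the groups (\<open>direct_limit_subgroups_iso\<close>). Relative hyperbolicity supplies the finite
  relative presentation of each group from which the enlargement starts.
\<close>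

section \<open>Word problems and presentations\<close>

lemma words_Nil [simp]: "[] \<in> words X"
  by (simp add: words_def)

lemma words_Cons [simp]: "p # w \<in> words X \<longleftrightarrow> fst p \<in> X \<and> w \<in> words X"
  by (cases p) (auto simp: words_def)

lemma words_append [simp]: "u @ v \<in> words X \<longleftrightarrow> u \<in> words X \<and> v \<in> words X"
  by (auto simp: words_def)

lemma words_mono: "X \<subseteq> Y \<Longrightarrow> words X \<subseteq> words Y"
  unfolding words_def by (intro lists_mono) auto

lemma word_eq_words: "(u, v) \<in> word_eq X Q \<Longrightarrow> u \<in> words X \<and> v \<in> words X"
  by (induction rule: word_eq.induct) (auto simp: inv_letter_def)

lemma word_eq_mono:
  assumes "X \<subseteq> Y" "Q \<subseteq> Q'"
  shows "(u, v) \<in> word_eq X Q \<Longrightarrow> (u, v) \<in> word_eq Y Q'"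
proof (induction rule: word_eq.induct)
  case (trans u v w)
  then show ?case by (blast intro: word_eq.trans)
next
  case (cancel u v p)
  then show ?case using assms words_mono[OF assms(1)] by (intro word_eq.cancel) auto
next
  case (relator u v q)
  then show ?case using assms words_mono[OF assms(1)] by (intro word_eq.relator) auto
qed (use assms words_mono[OF assms(1)] in \<open>auto intro: word_eq.intros\<close>)

lemma word_eq_context:
  assumes "a \<in> words X" "b \<in> words X"
  shows "(u, v) \<in> word_eq X Q \<Longrightarrow> (a @ u @ b, a @ v @ b) \<in> word_eq X Q"
proof (induction rule: word_eq.induct)
  case (refl u)
  then show ?case using assms by (intro word_eq.refl) simp
next
  case (sym u v)
  show ?case by (rule word_eq.sym) fact
next
  case (trans u v w)
  show ?case by (rule word_eq.trans) fact+
next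
  case (cancel u v p)
  then show ?case using assms word_eq.cancel[of "a @ u" X "v @ b" p Q] by simp
next
  case (relator u v q)
  then show ?case using assms word_eq.relator[of "a @ u" X "v @ b" q Q] by simp
qed

lemma word_eq_append:
  assumes "(u, u') \<in> word_eq X Q" "(v, v') \<in> word_eq X Q"
  shows "(u @ v, u' @ v') \<in> word_eq X Q"
proof (rule word_eq.trans)
  show "(u @ v, u' @ v) \<in> word_eq X Q"
    using word_eq_context[of "[]" X v u u' Q] assms word_eq_words by fastforce
  show "(u' @ v, u' @ v') \<in> word_eq X Q"
    using word_eq_context[of u' X "[]" v v' Q] assms word_eq_words by fastforce
qed

lemma equiv_word_eq: "equiv (words X) (word_eq X Q)"
proof (rule equivI)
  show "word_eq X Q \<subseteq> words X \<times> words X" using word_eq_words by fastforce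
  show "refl_on (words X) (word_eq X Q)"
    by (auto simp: refl_on_def intro: word_eq.refl)
  show "sym (word_eq X Q)" by (auto intro: symI word_eq.sym)
  show "trans (word_eq X Q)" by (auto intro: transI word_eq.trans)
qed

lemma word_class_eq_iff:
  "u \<in> words X \<Longrightarrow> v \<in> words X \<Longrightarrow>
   word_eq X Q `` {u} = word_eq X Q `` {v} \<longleftrightarrow> (u, v) \<in> word_eq X Q"
  using eq_equiv_class_iff[OF equiv_word_eq] by metis

lemma presented_group_mult:
  assumes "u \<in> words X" "v \<in> words X"
  shows "word_eq X Q `` {u} \<otimes>\<^bsub>presented_group X Q\<^esub> word_eq X Q `` {v} = word_eq X Q `` {u @ v}"
proof -
  have "congruent2 (word_eq X Q) (word_eq X Q) (\<lambda>u v. word_eq X Q `` {u @ v})"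
  proof (rule congruent2I')
    fix u u' v v' assume "(u, u') \<in> word_eq X Q" "(v, v') \<in> word_eq X Q"
    then show "word_eq X Q `` {u @ v} = word_eq X Q `` {u' @ v'}"
      using equiv_class_eq[OF equiv_word_eq word_eq_append] by metis
  qed
  from UN_equiv_class2[OF equiv_word_eq equiv_word_eq this assms] show ?thesis
    by (simp add: presented_group_def)
qed

lemma presented_group_carrier:
  "w \<in> words X \<Longrightarrow> word_eq X Q `` {w} \<in> carrier (presented_group X Q)"
  by (simp add: presented_group_def quotientI)

lemma word_value_Nil [simp]: "word_value G val [] = \<one>\<^bsub>G\<^esub>"
  by (simp add: word_value_def)

lemma word_value_Cons [simp]:
  "word_value G val (p # w) =
     (if snd p then val (fst p) else inv\<^bsub>G\<^esub> val (fst p)) \<otimes>\<^bsub>G\<^esub> word_value G val w"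
  by (cases p) (simp add: word_value_def)

text \<open>Presented groups and word values are defined for the unextended record type \<^typ>\<open>'a monoid\<close>,
  whereas the locale \<^locale>\<open>group\<close> allows record extensions.\<close>

locale plain_group = group G for G :: "'a monoid" (structure)

lemma (in plain_group) word_value_closed [simp]:
  "val ` X \<subseteq> carrier G \<Longrightarrow> w \<in> words X \<Longrightarrow> word_value G val w \<in> carrier G"
  by (induction w) auto

lemma (in plain_group) word_value_append:
  assumes "val ` X \<subseteq> carrier G" "v \<in> words X"
  shows "u \<in> words X \<Longrightarrow> word_value G val (u @ v) = word_value G val u \<otimes> word_value G val v"
proof (induction u)
  case Nil
  then show ?case using assms by simp
next
  case (Cons p u)
  have "val (fst p) \<in> carrier G" using assms Cons.prems by auto
  then show ?case using Cons assms(2) word_value_closed[OF assms(1)] by (simp add: m_assoc)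
qed

lemma (in plain_group) word_eq_imp_value_eq:
  assumes val: "val ` X \<subseteq> carrier G" and Q: "\<And>q. q \<in> Q \<Longrightarrow> word_value G val q = \<one>"
  shows "(u, v) \<in> word_eq X Q \<Longrightarrow> word_value G val u = word_value G val v"
proof (induction rule: word_eq.induct)
  case (cancel u v p)
  then have "val (fst p) \<in> carrier G" using val by auto
  then have "word_value G val [p, inv_letter p] = \<one>"
    by (simp add: inv_letter_def)
  moreover have "[p, inv_letter p] \<in> words X" using cancel by (auto simp: inv_letter_def)
  ultimately show ?case
    using cancel val by (simp del: word_value_Cons append_Cons words_Cons add: word_value_append)
next
  case (relator u v q)
  then show ?case using val Q by (simp add: word_value_append)
qed auto

text \<open>The isomorphism is forced to be evaluation of words, so its existence says that evaluation is onto
  and that its fibres are the classes of \<^const>\<open>word_eq\<close>. Changes of generators and relators are much easier to follow in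
  this form.\<close>

lemma (in plain_group) is_presentation_iff:
  "is_presentation G val X Q \<longleftrightarrow>
     Q \<subseteq> words X \<and> val ` X \<subseteq> carrier G \<and> carrier G \<subseteq> word_value G val ` words X \<and>
     (\<forall>u\<in>words X. \<forall>v\<in>words X.
        word_value G val u = word_value G val v \<longleftrightarrow> (u, v) \<in> word_eq X Q)"
  (is "?L \<longleftrightarrow> ?R")
proof
  let ?cl = "\<lambda>w. word_eq X Q `` {w}" and ?P = "presented_group X Q"
  assume ?L
  then obtain f where Q: "Q \<subseteq> words X" and f: "f \<in> iso ?P G"
    and fval: "\<And>x. x \<in> X \<Longrightarrow> f (?cl [(x, True)]) = val x"
    unfolding is_presentation_def by auto
  have fcarr: "f (?cl w) \<in> carrier G" if "w \<in> words X" for w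
    using f presented_group_carrier[OF that] by (auto simp: iso_def hom_def)
  have fmult: "f (?cl (u @ v)) = f (?cl u) \<otimes> f (?cl v)" if "u \<in> words X" "v \<in> words X" for u v
    using f presented_group_carrier[OF that(1)] presented_group_carrier[OF that(2)]
      presented_group_mult[OF that] by (auto simp: iso_def hom_def) metis
  have val: "val ` X \<subseteq> carrier G"
    using fval fcarr by (metis fst_conv image_subsetI words_Cons words_Nil)
  have f1: "f (?cl []) = \<one>"
    using fmult[of "[]" "[]"] fcarr[of "[]"] by simp
  have finv: "f (?cl [(x, False)]) = inv (val x)" if "x \<in> X" for x
  proof -
    have "([(x, True), (x, False)], []) \<in> word_eq X Q"
      using word_eq.cancel[of "[]" X "[]" "(x, True)" Q] that by (simp add: inv_letter_def)
    then have "?cl ([(x, True)] @ [(x, False)]) = ?cl []"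
      using equiv_class_eq[OF equiv_word_eq] by fastforce
    then have "val x \<otimes> f (?cl [(x, False)]) = \<one>"
      using fmult[of "[(x, True)]" "[(x, False)]"] fval[OF that] f1 that by simp
    then show ?thesis
      using inv_solve_left'[of "f (?cl [(x, False)])" "val x" \<one>] val fcarr[of "[(x, False)]"] that
      by auto
  qed
  have fw: "f (?cl w) = word_value G val w" if "w \<in> words X" for w
    using that
  proof (induction w)
    case Nil
    show ?case by (simp add: f1)
  next
    case (Cons p w)
    have "f (?cl [p]) = (if snd p then val (fst p) else inv (val (fst p)))"
      using Cons.prems fval finv by (cases p) auto
    then show ?case using Cons fmult[of "[p]" w] by simp
  qed
  have bij: "bij_betw f (carrier ?P) (carrier G)" using f by (simp add: iso_def)
  have "carrier G \<subseteq> word_value G val ` words X"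
  proof
    fix g assume "g \<in> carrier G"
    then obtain A where A: "A \<in> carrier ?P" "f A = g"
      using bij by (metis bij_betw_imp_surj_on imageE)
    then obtain w where "w \<in> words X" "A = ?cl w"
      by (auto simp: presented_group_def elim: quotientE)
    then show "g \<in> word_value G val ` words X" using A fw by auto
  qed
  moreover have "word_value G val u = word_value G val v \<longleftrightarrow> (u, v) \<in> word_eq X Q"
    if "u \<in> words X" "v \<in> words X" for u v
  proof -
    have "f (?cl u) = f (?cl v) \<longleftrightarrow> ?cl u = ?cl v"
      using bij presented_group_carrier[OF that(1)] presented_group_carrier[OF that(2)]
      by (metis bij_betw_def inj_on_eq_iff)
    then show ?thesis using fw that word_class_eq_iff by metis
  qed
  ultimately show ?R using Q val by blast
next
  let ?cl = "\<lambda>w. word_eq X Q `` {w}" and ?P = "presented_group X Q"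
  assume R: ?R
  define f where "f A = word_value G val (SOME w. w \<in> A)" for A
  have f: "f (?cl w) = word_value G val w" if "w \<in> words X" for w
  proof -
    have "w \<in> ?cl w" using that by (auto intro: word_eq.refl)
    then have "(SOME v. v \<in> ?cl w) \<in> ?cl w" by (rule someI)
    then have r: "(w, SOME v. v \<in> ?cl w) \<in> word_eq X Q" by simp
    then have "(SOME v. v \<in> ?cl w) \<in> words X" using word_eq_words by blast
    then show ?thesis using R that r unfolding f_def by metis
  qed
  have reps: "\<exists>w\<in>words X. A = ?cl w" if "A \<in> carrier ?P" for A
    using that by (auto simp: presented_group_def elim: quotientE)
  have "f \<in> hom ?P G"
  proof (rule homI)
    fix A assume "A \<in> carrier ?P"
    then show "f A \<in> carrier G" using reps[of A] f R word_value_closed by metis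
  next
    fix A B assume "A \<in> carrier ?P" "B \<in> carrier ?P"
    then obtain u v where "u \<in> words X" "A = ?cl u" "v \<in> words X" "B = ?cl v"
      using reps by metis
    then show "f (A \<otimes>\<^bsub>?P\<^esub> B) = f A \<otimes> f B"
      using R word_value_append[of val X] by (simp add: presented_group_mult f)
  qed
  moreover have "inj_on f (carrier ?P)"
  proof (rule inj_onI)
    fix A B assume "A \<in> carrier ?P" "B \<in> carrier ?P" "f A = f B"
    moreover from this obtain u v where "u \<in> words X" "A = ?cl u" "v \<in> words X" "B = ?cl v"
      using reps by metis
    ultimately show "A = B" using R by (simp add: f word_class_eq_iff)
  qed
  moreover have "f ` carrier ?P = carrier G"
  proof
    show "f ` carrier ?P \<subseteq> carrier G"
      using \<open>f \<in> hom ?P G\<close> by (auto simp: hom_def)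
    show "carrier G \<subseteq> f ` carrier ?P"
    proof
      fix g assume "g \<in> carrier G"
      then obtain w where "w \<in> words X" "g = word_value G val w" using R by blast
      then show "g \<in> f ` carrier ?P" using f presented_group_carrier by (metis image_eqI)
    qed
  qed
  ultimately have "f \<in> iso ?P G" by (simp add: iso_def bij_betw_def)
  moreover have "f (?cl [(x, True)]) = val x" if "x \<in> X" for x
    using f[of "[(x, True)]"] that R by (auto simp: image_subset_iff)
  ultimately show ?L using R unfolding is_presentation_def by (intro conjI bexI[of _ f]) auto
qed

text \<open>The Tietze move that adds a redundant generator \<open>y\<close> together with the relator \<open>y\<inverse>w\<close>. The relator
  lets every \<open>y\<close> be replaced by \<open>w\<close>, so a word in the new generators is equal, in the new presentation,
  to one in the old generators; two such words with the same value are already equal in the old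
  presentation.\<close>

lemma (in plain_group) is_presentation_add_generator:
  assumes pres: "is_presentation G val X Q"
    and w: "w \<in> words X" "word_value G val w = val y"
  shows "is_presentation G val (insert y X) (insert ((y, False) # w) Q)"
proof -
  let ?X = "insert y X" and ?r = "(y, False) # w"
  let ?Q = "insert ?r Q"
  from pres have Q: "Q \<subseteq> words X" and val: "val ` X \<subseteq> carrier G"
    and onto: "carrier G \<subseteq> word_value G val ` words X"
    and eq: "\<And>u v. u \<in> words X \<Longrightarrow> v \<in> words X \<Longrightarrow>
        word_value G val u = word_value G val v \<longleftrightarrow> (u, v) \<in> word_eq X Q"
    unfolding is_presentation_iff by auto
  have sub: "words X \<subseteq> words ?X" by (rule words_mono) auto
  have vy: "val y \<in> carrier G" using w val word_value_closed by metis
  then have val': "val ` ?X \<subseteq> carrier G" using val by auto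
  have Q1: "word_value G val q = \<one>" if "q \<in> ?Q" for q
  proof (cases "q = ?r")
    case True
    then show ?thesis using w vy by simp
  next
    case False
    then have "q \<in> Q" "q \<in> words X" using that Q by auto
    then show ?thesis
      using eq[of q "[]"] word_eq.relator[of "[]" X "[]" q Q] by simp
  qed
  have lift: "(u, v) \<in> word_eq X Q \<Longrightarrow> (u, v) \<in> word_eq ?X ?Q" for u v
    by (rule word_eq_mono) auto
  have rword: "?r \<in> words ?X" using w sub by auto
  have letter: "\<exists>v\<in>words X. ([(x, b)], v) \<in> word_eq ?X ?Q" if "x \<in> ?X" for x b
  proof (cases "x \<in> X")
    case True
    then show ?thesis by (intro bexI[of _ "[(x, b)]"] word_eq.refl) auto
  next
    case False
    then have [simp]: "x = y" using that by auto
    show ?thesis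
    proof (cases b)
      case True
      have "([(y, True)] @ ?r @ [], [(y, True)] @ []) \<in> word_eq ?X ?Q"
        using rword by (intro word_eq.relator) auto
      moreover have "([] @ [(y, True), inv_letter (y, True)] @ w, [] @ w) \<in> word_eq ?X ?Q"
        using w sub by (intro word_eq.cancel) auto
      ultimately have "([(y, True)], w) \<in> word_eq ?X ?Q"
        by (auto simp: inv_letter_def intro: word_eq.sym word_eq.trans)
      then show ?thesis using w True by auto
    next
      case False
      \<comment> \<open>The relator only handles \<open>y\<inverse>\<close> in front of \<open>w\<close>. A word \<open>w'\<close> for the inverse element makes
        \<open>w w'\<close> trivial in the old presentation, hence \<open>y\<inverse> = y\<inverse> w w' = w'\<close>.\<close>
      obtain w' where w': "w' \<in> words X" "word_value G val w' = inv (val y)"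
        using onto vy by (metis image_iff inv_closed subsetD)
      then have "word_value G val (w @ w') = word_value G val []"
        using w vy by (simp add: word_value_append[OF val])
      then have "(w @ w', []) \<in> word_eq X Q" using eq[of "w @ w'" "[]"] w w' by simp
      then have "([(y, False)] @ (w @ w') @ [], [(y, False)] @ [] @ []) \<in> word_eq ?X ?Q"
        by (intro word_eq_context lift) auto
      moreover have "([] @ ?r @ w', [] @ w') \<in> word_eq ?X ?Q"
        using w' sub rword by (intro word_eq.relator) auto
      ultimately have "([(y, False)], w') \<in> word_eq ?X ?Q"
        by (auto intro: word_eq.sym word_eq.trans)
      then show ?thesis using w' False by auto
    qed
  qed
  have old: "\<exists>v\<in>words X. (u, v) \<in> word_eq ?X ?Q" if "u \<in> words ?X" for u
    using that
  proof (induction u)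
    case Nil
    show ?case by (intro bexI[of _ "[]"] word_eq.refl) auto
  next
    case (Cons p u)
    then obtain v where v: "v \<in> words X" "(u, v) \<in> word_eq ?X ?Q" by auto
    obtain v' where v': "v' \<in> words X" "([p], v') \<in> word_eq ?X ?Q"
      using letter[of "fst p" "snd p"] Cons.prems by auto
    show ?case
      using word_eq_append[OF v'(2) v(2)] v v' by (intro bexI[of _ "v' @ v"]) auto
  qed
  have "word_value G val u = word_value G val v \<longleftrightarrow> (u, v) \<in> word_eq ?X ?Q"
    if uv: "u \<in> words ?X" "v \<in> words ?X" for u v
  proof
    assume same: "word_value G val u = word_value G val v"
    obtain u' v' where u': "u' \<in> words X" "(u, u') \<in> word_eq ?X ?Q"
      and v': "v' \<in> words X" "(v, v') \<in> word_eq ?X ?Q" using old uv by metis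
    have "word_value G val u' = word_value G val v'"
      using same word_eq_imp_value_eq[OF val' Q1 u'(2)] word_eq_imp_value_eq[OF val' Q1 v'(2)]
      by simp
    then have "(u', v') \<in> word_eq ?X ?Q" using eq u' v' lift by simp
    then show "(u, v) \<in> word_eq ?X ?Q"
      using u' v' by (blast intro: word_eq.sym word_eq.trans)
  qed (rule word_eq_imp_value_eq[OF val' Q1])
  moreover have "?Q \<subseteq> words ?X" using Q sub rword by auto
  moreover have "carrier G \<subseteq> word_value G val ` words ?X" using onto sub by blast
  ultimately show ?thesis using val' unfolding is_presentation_iff by blast
qed

section \<open>Enlarging a finite relative presentation\<close>

lemma not_successivelyE:
  assumes "\<not> successively P w"
  obtains a x y b where "w = a @ x # y # b" "\<not> P x y"
proof -
  obtain i where i: "Suc i < length w" "\<not> P (w ! i) (w ! Suc i)"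
    using assms by (auto simp: successively_conv_nth)
  have "w = take i w @ w ! i # w ! Suc i # drop (Suc (Suc i)) w"
    using i by (metis Cons_nth_drop_Suc Suc_lessD append_take_drop_id)
  with i show ?thesis using that by blast
qed

text \<open>Words in which every peripheral letter is positive still represent every element, because the
  subgroups \<open>H l\<close> are closed under inverses. A shortest such word is in normal form: a trivial syllable,
  two adjacent syllables from one \<open>H l\<close>, or a letter next to its inverse would allow a shorter word.\<close>

lemma (in plain_group) normal_form_exists:
  fixes H :: "'l \<Rightarrow> 'a set"
  assumes pres: "finite_rel_presentation G \<Lambda> H S R"
    and H: "\<And>l. l \<in> \<Lambda> \<Longrightarrow> subgroup (H l) G"
    and t: "t \<in> carrier G"
  obtains w where "w \<in> free_product_elems G \<Lambda> H S" "word_value G rel_val w = t"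
proof -
  let ?X = "rel_gens \<Lambda> H S"
  define positive :: "('a, 'l) rel_gen word \<Rightarrow> bool"
    where "positive w \<longleftrightarrow> (\<forall>p\<in>set w. isl (fst p) \<or> snd p)" for w
  define good where "good w \<longleftrightarrow> w \<in> words ?X \<and> positive w \<and> word_value G rel_val w = t" for w
  from pres have val: "rel_val ` ?X \<subseteq> carrier G"
    and onto: "carrier G \<subseteq> word_value G rel_val ` words ?X"
    unfolding finite_rel_presentation_def is_presentation_iff by auto
  have make_positive: "\<exists>w'. w' \<in> words ?X \<and> positive w' \<and> word_value G rel_val w' = word_value G rel_val w"
    if "w \<in> words ?X" for w
    using that
  proof (induction w)
    case Nil
    then show ?case by (intro exI[of _ "[]"]) (auto simp: positive_def)
  next
    case (Cons p w)
    then obtain w' where w': "w' \<in> words ?X" "positive w'"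
      "word_value G rel_val w' = word_value G rel_val w" by auto
    show ?case
    proof (cases "\<exists>l h. p = (Inr (l, h), False)")
      case True
      then obtain l h where p: "p = (Inr (l, h), False)" by auto
      then have lh: "l \<in> \<Lambda>" "h \<in> H l" using Cons.prems by (auto simp: rel_gens_def)
      then have "inv h \<in> H l" using subgroup.m_inv_closed[OF H] by simp
      then show ?thesis using w' p lh
        by (intro exI[of _ "(Inr (l, inv h), True) # w'"])
           (auto simp: positive_def rel_gens_def rel_val_def)
    next
      case False
      then show ?thesis using w' Cons.prems
        by (intro exI[of _ "p # w'"], cases p, cases "fst p") (auto simp: positive_def)
    qed
  qed
  obtain w0 where "w0 \<in> words ?X" "word_value G rel_val w0 = t" using onto t by blast
  then have "\<exists>w. good w" using make_positive[of w0] unfolding good_def by auto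
  then obtain w where w: "good w" and min: "\<And>v. good v \<Longrightarrow> length w \<le> length v"
    using ex_has_least_nat[of good _ length] by metis
  have shorten: False
    if "w = a @ m @ b" "m' \<in> words ?X" "positive m'" "length m' < length m"
      "word_value G rel_val m' = word_value G rel_val m" for a m m' b
  proof -
    have ab: "a \<in> words ?X" "m \<in> words ?X" "b \<in> words ?X"
      using w that(1) by (auto simp: good_def)
    have "good (a @ m' @ b)"
      using w that ab unfolding good_def positive_def by (auto simp: word_value_append[OF val])
    then show False using min that by fastforce
  qed
  have nontrivial: "b \<and> h \<noteq> \<one>" if mem: "(Inr (l, h), b) \<in> set w" for l h b
  proof
    show b using w mem by (force simp: good_def positive_def)
    show "h \<noteq> \<one>"
    proof
      assume "h = \<one>"
      moreover obtain a c where "w = a @ [(Inr (l, h), b)] @ c"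
        using split_list[OF mem] by auto
      ultimately show False
        using shorten[of a "[(Inr (l, h), b)]" c "[]"]
        by (cases b) (simp_all add: positive_def rel_val_def)
    qed
  qed
  have "successively adjacent_ok w"
  proof (rule ccontr)
    assume "\<not> successively adjacent_ok w"
    then obtain a p q c where w': "w = a @ p # q # c" and bad: "\<not> adjacent_ok p q"
      by (rule not_successivelyE)
    have pq: "fst p \<in> ?X" "fst q \<in> ?X" using w w' by (auto simp: good_def)
    consider s b where "p = (Inl s, b)" "q = (Inl s, \<not> b)"
      | l h k b d where "p = (Inr (l, h), b)" "q = (Inr (l, k), d)"
      using bad by (cases "(p, q)" rule: adjacent_ok.cases) auto
    then show False
    proof cases
      case 1
      moreover have "s \<in> carrier G" using 1 pq val by (auto simp: rel_val_def)
      ultimately show False using w' shorten[of a "[p, q]" c "[]"]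
        by (cases b) (auto simp: positive_def rel_val_def)
    next
      case 2
      then have "b" "d" using nontrivial w' by auto
      moreover have lhk: "l \<in> \<Lambda>" "h \<in> H l" "k \<in> H l" using 2 pq by (auto simp: rel_gens_def)
      moreover have "h \<in> carrier G" "k \<in> carrier G" "h \<otimes> k \<in> H l"
        using lhk subgroup.mem_carrier[OF H] subgroup.m_closed[OF H] by auto
      ultimately show False using 2 w' shorten[of a "[p, q]" c "[(Inr (l, h \<otimes> k), True)]"]
        by (auto simp: positive_def rel_val_def rel_gens_def)
    qed
  qed
  then have "w \<in> free_product_elems G \<Lambda> H S"
    using w nontrivial unfolding free_product_elems_def good_def by blast
  then show ?thesis using w that by (auto simp: good_def)
qed

lemma rel_gens_insert: "rel_gens \<Lambda> H (insert t S) = insert (Inl t) (rel_gens \<Lambda> H S)"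
  by (auto simp: rel_gens_def)

lemma (in plain_group) finite_rel_presentation_add_generator:
  assumes pres: "finite_rel_presentation G \<Lambda> H S R"
    and H: "\<And>l. l \<in> \<Lambda> \<Longrightarrow> subgroup (H l) G"
    and t: "t \<in> carrier G"
  shows "\<exists>R'. finite_rel_presentation G \<Lambda> H (insert t S) R'"
proof (cases "t \<in> S")
  case True
  then show ?thesis using pres by (metis insert_absorb)
next
  case False
  let ?X = "rel_gens \<Lambda> H S"
  obtain w where w: "w \<in> free_product_elems G \<Lambda> H S" "word_value G rel_val w = t"
    using normal_form_exists[OF pres H t] by metis
  let ?r = "(Inl t, False) # w"
  have ww: "w \<in> words ?X" using w by (simp add: free_product_elems_def)
  have mono: "free_product_elems G \<Lambda> H S \<subseteq> free_product_elems G \<Lambda> H (insert t S)"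
    using words_mono[of ?X "rel_gens \<Lambda> H (insert t S)"]
    by (auto simp: free_product_elems_def rel_gens_insert)
  \<comment> \<open>\<open>t\<close> is a new letter, so it does not cancel against the first letter of \<open>w\<close>.\<close>
  have "adjacent_ok (Inl t, False) (hd w)" if "w \<noteq> []"
  proof -
    have "fst (hd w) \<in> ?X" using ww that by (cases w) auto
    then show ?thesis using False
      by (cases "hd w") (auto simp: rel_gens_def)
  qed
  then have "successively adjacent_ok ?r"
    using w by (auto simp: free_product_elems_def successively_Cons)
  then have "?r \<in> free_product_elems G \<Lambda> H (insert t S)"
    using w mono by (auto simp: free_product_elems_def rel_gens_insert)
  moreover have "is_presentation G rel_val (insert (Inl t) ?X)
      (insert ?r (R \<union> peripheral_relators G \<Lambda> H))"
    using pres ww w by (intro is_presentation_add_generator)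
      (auto simp: finite_rel_presentation_def rel_val_def)
  ultimately have "finite_rel_presentation G \<Lambda> H (insert t S) (insert ?r R)"
    using pres t mono unfolding finite_rel_presentation_def rel_gens_insert by auto
  then show ?thesis by blast
qed

lemma (in plain_group) finite_rel_presentation_add_generators:
  assumes pres: "finite_rel_presentation G \<Lambda> H S R"
    and H: "\<And>l. l \<in> \<Lambda> \<Longrightarrow> subgroup (H l) G"
  shows "finite T \<Longrightarrow> T \<subseteq> carrier G \<Longrightarrow> \<exists>R'. finite_rel_presentation G \<Lambda> H (T \<union> S) R'"
proof (induction T rule: finite_induct)
  case empty
  then show ?case using pres by auto
next
  case (insert t T)
  then show ?case using finite_rel_presentation_add_generator[OF _ H] by fastforce
qed

section \<open>The core\<close>

text \<open>The peripheral subgroups that generate the core are themselves generated by the elements of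
  \<open>core_omega\<close>, so these can serve as generators directly; this exhibits the core as generated by a
  finite set.\<close>

definition core_gens ::
    "'a monoid \<Rightarrow> 'l set \<Rightarrow> ('l \<Rightarrow> 'a set) \<Rightarrow> 'a set \<Rightarrow> ('a, 'l) rel_gen word set \<Rightarrow> 'a set" where
  "core_gens G \<Lambda> H S R = S \<union> (core_omega G R \<inter> (\<Union>l\<in>\<Lambda>. H l))"

lemma finite_core_gens:
  assumes "finite S" "finite R"
  shows "finite (core_gens G \<Lambda> H S R)"
proof -
  have "core_omega G R \<subseteq> (\<lambda>p. rel_val (fst p)) ` (\<Union>r\<in>R. set r)"
    unfolding core_omega_def rel_val_def by force
  then have "finite (core_omega G R)" using assms by (auto intro: finite_subset)
  then show ?thesis using assms by (simp add: core_gens_def)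
qed

lemma (in plain_group) core_gens_subset:
  assumes "S \<subseteq> carrier G" "\<And>l. l \<in> \<Lambda> \<Longrightarrow> subgroup (H l) G"
  shows "core_gens G \<Lambda> H S R \<subseteq> carrier G"
  using assms subgroup.subset[OF assms(2)] by (auto simp: core_gens_def)

lemma (in plain_group) fg_core_eq:
  assumes S: "S \<subseteq> carrier G" and H: "\<And>l. l \<in> \<Lambda> \<Longrightarrow> subgroup (H l) G"
  shows "fg_core G \<Lambda> H S R = G\<lparr>carrier := generate G (core_gens G \<Lambda> H S R)\<rparr>"
proof -
  let ?A = "core_gens G \<Lambda> H S R"
  let ?B = "S \<union> (\<Union>i\<in>core_index G \<Lambda> H R. core_subgroup G H R i)"
  have A: "?A \<subseteq> carrier G" by (rule core_gens_subset[OF S H])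
  have "core_subgroup G H R i \<subseteq> generate G ?A" if "i \<in> \<Lambda>" for i
    unfolding core_subgroup_def using that by (intro mono_generate) (auto simp: core_gens_def)
  moreover have "S \<subseteq> generate G ?A"
    by (auto simp: core_gens_def intro: generate.incl)
  ultimately have B: "?B \<subseteq> generate G ?A" by (auto simp: core_index_def)
  have "?A \<subseteq> ?B"
    by (auto simp: core_gens_def core_index_def core_subgroup_def intro: generate.incl)
  then have "generate G ?A \<subseteq> generate G ?B" by (rule mono_generate)
  moreover have "generate G ?B \<subseteq> generate G ?A"
    using generate_subgroup_incl[OF B generate_is_subgroup[OF A]] .
  ultimately show ?thesis by (simp add: fg_core_def)
qed

section \<open>Direct limits\<close>

lemma limit_seqs_iff:
  "g \<in> limit_seqs Gs \<phi> \<longleftrightarrow> (\<forall>i. g i \<in> carrier (Gs i)) \<and> (\<exists>J. \<forall>j\<ge>J. g (Suc j) = \<phi> j (g j))"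
  by (auto simp: limit_seqs_def PiE_iff)

lemma equiv_limit_rel: "equiv (limit_seqs Gs \<phi>) (limit_rel Gs \<phi>)"
proof (rule equivI)
  show "limit_rel Gs \<phi> \<subseteq> limit_seqs Gs \<phi> \<times> limit_seqs Gs \<phi>" by (auto simp: limit_rel_def)
  show "refl_on (limit_seqs Gs \<phi>) (limit_rel Gs \<phi>)"
    by (auto simp: refl_on_def limit_rel_def)
  show "sym (limit_rel Gs \<phi>)" by (rule symI) (auto simp: limit_rel_def, metis)
  show "trans (limit_rel Gs \<phi>)"
  proof (rule transI)
    fix f g h assume "(f, g) \<in> limit_rel Gs \<phi>" "(g, h) \<in> limit_rel Gs \<phi>"
    moreover from this obtain K L where "\<forall>k\<ge>K. f k = g k" "\<forall>k\<ge>L. g k = h k"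
      by (auto simp: limit_rel_def)
    then have "\<forall>k\<ge>max K L. f k = h k" by simp
    ultimately show "(f, h) \<in> limit_rel Gs \<phi>" unfolding limit_rel_def by blast
  qed
qed

lemma hom_subgroups:
  assumes "f \<in> hom G H" "subgroup K G" "f ` K \<subseteq> L"
  shows "f \<in> hom (G\<lparr>carrier := K\<rparr>) (H\<lparr>carrier := L\<rparr>)"
  using assms subgroup.subset[OF assms(2)] by (intro homI) (auto simp: hom_def subset_iff)

locale group_sequence =
  fixes Gs :: "nat \<Rightarrow> 'a monoid" and \<phi> :: "nat \<Rightarrow> 'a \<Rightarrow> 'a"
  assumes grp: "group (Gs i)" and hom: "\<phi> i \<in> hom (Gs i) (Gs (Suc i))"

lemma (in group_sequence) limit_seqs_mult:
  assumes g: "g \<in> limit_seqs Gs \<phi>" and h: "h \<in> limit_seqs Gs \<phi>"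
  shows "g \<otimes>\<^bsub>product_group UNIV Gs\<^esub> h \<in> limit_seqs Gs \<phi>"
proof -
  obtain J K where "\<forall>j\<ge>J. g (Suc j) = \<phi> j (g j)" "\<forall>j\<ge>K. h (Suc j) = \<phi> j (h j)"
    using g h by (auto simp: limit_seqs_iff)
  then have eventually: "\<forall>j\<ge>max J K. g (Suc j) \<otimes>\<^bsub>Gs (Suc j)\<^esub> h (Suc j) = \<phi> j (g j \<otimes>\<^bsub>Gs j\<^esub> h j)"
    using g h hom_mult[OF hom] by (simp add: limit_seqs_iff)
  have "g i \<otimes>\<^bsub>Gs i\<^esub> h i \<in> carrier (Gs i)" for i
    using g h monoid.m_closed[OF group.is_monoid[OF grp]] by (auto simp: limit_seqs_iff)
  then show ?thesis
    using eventually unfolding limit_seqs_iff by (intro conjI allI exI[of _ "max J K"]) simp_all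
qed

lemma (in group_sequence) direct_limit_mult:
  assumes g: "g \<in> limit_seqs Gs \<phi>" and h: "h \<in> limit_seqs Gs \<phi>"
  shows "limit_rel Gs \<phi> `` {g} \<otimes>\<^bsub>direct_limit Gs \<phi>\<^esub> limit_rel Gs \<phi> `` {h} =
     limit_rel Gs \<phi> `` {g \<otimes>\<^bsub>product_group UNIV Gs\<^esub> h}"
proof -
  let ?m = "\<lambda>g h. g \<otimes>\<^bsub>product_group UNIV Gs\<^esub> h"
  have "congruent2 (limit_rel Gs \<phi>) (limit_rel Gs \<phi>) (\<lambda>g h. limit_rel Gs \<phi> `` {?m g h})"
  proof (rule congruent2I')
    fix g g' h h' assume gg: "(g, g') \<in> limit_rel Gs \<phi>" and hh: "(h, h') \<in> limit_rel Gs \<phi>"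
    obtain K L where "\<forall>k\<ge>K. g k = g' k" "\<forall>k\<ge>L. h k = h' k"
      using gg hh by (auto simp: limit_rel_def)
    then have "\<forall>k\<ge>max K L. ?m g h k = ?m g' h' k" by simp
    moreover have "?m g h \<in> limit_seqs Gs \<phi>" "?m g' h' \<in> limit_seqs Gs \<phi>"
      using limit_seqs_mult gg hh unfolding limit_rel_def by blast+
    ultimately have "(?m g h, ?m g' h') \<in> limit_rel Gs \<phi>"
      unfolding limit_rel_def by blast
    then show "limit_rel Gs \<phi> `` {?m g h} = limit_rel Gs \<phi> `` {?m g' h'}"
      using equiv_class_eq[OF equiv_limit_rel] by metis
  qed
  from UN_equiv_class2[OF equiv_limit_rel equiv_limit_rel this g h] show ?thesis
    by (simp add: direct_limit_def)
qed

lemma direct_limit_carrier: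
  "A \<in> carrier (direct_limit Gs \<phi>) \<longleftrightarrow> (\<exists>g\<in>limit_seqs Gs \<phi>. A = limit_rel Gs \<phi> `` {g})"
  by (auto simp: direct_limit_def quotient_def)

text \<open>Subgroups \<open>K i\<close> that \<open>\<phi>\<close> respects have the same direct limit as the whole groups as soon as every
  element of every \<open>Gs i\<close> is eventually carried into them. Every class of sequences then contains a
  sequence in the subgroups, obtained by replacing finitely many entries by \<open>\<one>\<close>, so intersecting a
  class with the sequences in the subgroups is the isomorphism.\<close>

lemma (in group_sequence) direct_limit_subgroups_iso:
  assumes sub: "\<And>i. subgroup (K i) (Gs i)" and maps: "\<And>i. \<phi> i ` K i \<subseteq> K (Suc i)"
    and absorb: "\<And>g. g \<in> limit_seqs Gs \<phi> \<Longrightarrow> \<exists>N. \<forall>i\<ge>N. g i \<in> K i"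
  shows "direct_limit Gs \<phi> \<cong> direct_limit (\<lambda>i. (Gs i)\<lparr>carrier := K i\<rparr>) \<phi>"
proof -
  let ?Ks = "\<lambda>i. (Gs i)\<lparr>carrier := K i\<rparr>"
  let ?L = "limit_seqs ?Ks \<phi>" and ?G = "direct_limit Gs \<phi>" and ?D = "direct_limit ?Ks \<phi>"
  let ?f = "\<lambda>A. A \<inter> ?L"
  interpret sub: group_sequence ?Ks \<phi>
  proof (rule group_sequence.intro)
    show "group (?Ks i)" for i using subgroup.subgroup_is_group[OF sub grp] .
    show "\<phi> i \<in> hom (?Ks i) (?Ks (Suc i))" for i by (rule hom_subgroups[OF hom sub maps])
  qed
  have L_iff: "g \<in> ?L \<longleftrightarrow> g \<in> limit_seqs Gs \<phi> \<and> (\<forall>i. g i \<in> K i)" for g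
    using subgroup.subset[OF sub] by (auto simp: limit_seqs_iff)
  have rel_iff: "(g, h) \<in> limit_rel ?Ks \<phi> \<longleftrightarrow> (g, h) \<in> limit_rel Gs \<phi> \<and> g \<in> ?L \<and> h \<in> ?L" for g h
    using L_iff by (auto simp: limit_rel_def)
  have rep: "\<exists>h\<in>?L. (g, h) \<in> limit_rel Gs \<phi>" if g: "g \<in> limit_seqs Gs \<phi>" for g
  proof -
    obtain N where N: "\<forall>i\<ge>N. g i \<in> K i" using absorb[OF g] by auto
    obtain J where J: "\<forall>j\<ge>J. g (Suc j) = \<phi> j (g j)" using g by (auto simp: limit_seqs_iff)
    define h where "h i = (if i \<ge> N then g i else \<one>\<^bsub>Gs i\<^esub>)" for i
    have hK: "h i \<in> K i" for i using N subgroup.one_closed[OF sub] by (simp add: h_def)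
    moreover have "\<forall>j\<ge>max J N. h (Suc j) = \<phi> j (h j)" using J by (simp add: h_def)
    ultimately have "h \<in> ?L"
      unfolding limit_seqs_iff by (intro conjI allI exI[of _ "max J N"]) simp_all
    moreover have "\<forall>k\<ge>N. g k = h k" by (simp add: h_def)
    ultimately have "(g, h) \<in> limit_rel Gs \<phi>" using g L_iff unfolding limit_rel_def by blast
    then show ?thesis using \<open>h \<in> ?L\<close> by blast
  qed
  have G_rep: "\<exists>g\<in>?L. A = limit_rel Gs \<phi> `` {g}" if "A \<in> carrier ?G" for A
    using that rep equiv_class_eq[OF equiv_limit_rel] unfolding direct_limit_carrier by metis
  have f: "?f (limit_rel Gs \<phi> `` {g}) = limit_rel ?Ks \<phi> `` {g}" if "g \<in> ?L" for g
    using that by (auto simp: rel_iff)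
  have G_in: "limit_rel Gs \<phi> `` {g} \<in> carrier ?G" if "g \<in> ?L" for g
    using that L_iff direct_limit_carrier by blast
  have "?f \<in> hom ?G ?D"
  proof (rule homI)
    fix A assume "A \<in> carrier ?G"
    then obtain g where "g \<in> ?L" "A = limit_rel Gs \<phi> `` {g}" using G_rep by blast
    then show "?f A \<in> carrier ?D" using f[of g] unfolding direct_limit_carrier by auto
  next
    fix A B assume "A \<in> carrier ?G" "B \<in> carrier ?G"
    then obtain g h where g: "g \<in> ?L" "A = limit_rel Gs \<phi> `` {g}"
      and h: "h \<in> ?L" "B = limit_rel Gs \<phi> `` {h}" using G_rep by meson
    have "product_group UNIV ?Ks = product_group UNIV Gs\<lparr>carrier := Pi\<^sub>E UNIV K\<rparr>"
      by (simp add: product_group_def)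
    then have m: "g \<otimes>\<^bsub>product_group UNIV ?Ks\<^esub> h = g \<otimes>\<^bsub>product_group UNIV Gs\<^esub> h" by simp
    have "g \<otimes>\<^bsub>product_group UNIV Gs\<^esub> h \<in> ?L"
      using sub.limit_seqs_mult[OF g(1) h(1)] m by simp
    moreover have "A \<otimes>\<^bsub>?G\<^esub> B = limit_rel Gs \<phi> `` {g \<otimes>\<^bsub>product_group UNIV Gs\<^esub> h}"
      using g h L_iff direct_limit_mult by simp
    ultimately show "?f (A \<otimes>\<^bsub>?G\<^esub> B) = ?f A \<otimes>\<^bsub>?D\<^esub> ?f B"
      using g h sub.direct_limit_mult[OF g(1) h(1)] m by (simp add: f)
  qed
  moreover have "inj_on ?f (carrier ?G)"
  proof (rule inj_onI)
    fix A B assume AB: "A \<in> carrier ?G" "B \<in> carrier ?G" and eq: "?f A = ?f B"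
    obtain g h where g: "g \<in> ?L" "A = limit_rel Gs \<phi> `` {g}"
      and h: "h \<in> ?L" "B = limit_rel Gs \<phi> `` {h}"
      using G_rep[OF AB(1)] G_rep[OF AB(2)] by blast
    have "limit_rel ?Ks \<phi> `` {g} = limit_rel ?Ks \<phi> `` {h}"
      using eq g f[OF g(1)] h f[OF h(1)] by simp
    then have "(g, h) \<in> limit_rel ?Ks \<phi>"
      using eq_equiv_class[OF _ equiv_limit_rel h(1)] by blast
    then have "(g, h) \<in> limit_rel Gs \<phi>" using rel_iff by blast
    then show "A = B" using g h equiv_class_eq[OF equiv_limit_rel] by simp
  qed
  moreover have "?f ` carrier ?G = carrier ?D"
  proof
    show "?f ` carrier ?G \<subseteq> carrier ?D" using \<open>?f \<in> hom ?G ?D\<close> by (auto simp: hom_def)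
    show "carrier ?D \<subseteq> ?f ` carrier ?G"
    proof
      fix A assume "A \<in> carrier ?D"
      then obtain g where "g \<in> ?L" "A = limit_rel ?Ks \<phi> `` {g}"
        by (auto simp: direct_limit_carrier)
      then show "A \<in> ?f ` carrier ?G" using f[of g] G_in[of g] by (intro image_eqI) simp_all
    qed
  qed
  ultimately have "?f \<in> iso ?G ?D" by (simp add: iso_def bij_betw_def)
  then show ?thesis by (auto simp: is_iso_def)
qed

text \<open>\<open>push \<phi> j x n\<close> is the image of \<open>x \<in> G\<^sub>j\<close> in \<open>G\<^sub>j\<^sub>+\<^sub>n\<close>.\<close>

fun push :: "(nat \<Rightarrow> 'a \<Rightarrow> 'a) \<Rightarrow> nat \<Rightarrow> 'a \<Rightarrow> nat \<Rightarrow> 'a" where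
  "push \<phi> j x 0 = x"
| "push \<phi> j x (Suc n) = \<phi> (j + n) (push \<phi> j x n)"

lemma (in group_sequence) push_closed:
  assumes "x \<in> carrier (Gs j)"
  shows "push \<phi> j x n \<in> carrier (Gs (j + n))"
proof (induction n)
  case (Suc n)
  then show ?case using hom_in_carrier[OF hom[of "j + n"]] by simp
qed (use assms in simp)

lemma eventually_push:
  assumes "\<forall>j\<ge>J. g (Suc j) = \<phi> j (g j)"
  shows "g (J + n) = push \<phi> J (g J) n"
  by (induction n) (use assms in auto)

section \<open>The direct limit of the cores\<close>

theorem proposition11:
  fixes G :: "'b monoid"
    and Gs :: "nat \<Rightarrow> 'a monoid"
    and \<phi> :: "nat \<Rightarrow> 'a \<Rightarrow> 'a"
    and \<Lambda> :: "nat \<Rightarrow> 'l set"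
    and P :: "nat \<Rightarrow> 'l \<Rightarrow> 'a set"
  assumes "group G"
    and "\<And>i. group (Gs i)"
    and "\<And>i. \<phi> i \<in> hom (Gs i) (Gs (Suc i))"
    and "G \<cong> direct_limit Gs \<phi>"
    and "\<And>i. countable (carrier (Gs i))"
    and "\<And>i l. l \<in> \<Lambda> i \<Longrightarrow> subgroup (P i l) (Gs i) \<and> P i l \<noteq> carrier (Gs i)"
    and "\<And>i. rel_hyperbolic (Gs i) (\<Lambda> i) (P i)"
  shows "\<exists>(S :: nat \<Rightarrow> 'a set) (R :: nat \<Rightarrow> ('a, 'l) rel_gen word set) (\<phi>' :: nat \<Rightarrow> 'a \<Rightarrow> 'a).
    (\<forall>i. finite_rel_presentation (Gs i) (\<Lambda> i) (P i) (S i) (R i)) \<and>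
    (\<forall>i. finitely_generated (fg_core (Gs i) (\<Lambda> i) (P i) (S i) (R i))) \<and>
    (\<forall>i. \<phi>' i \<in> hom (fg_core (Gs i) (\<Lambda> i) (P i) (S i) (R i))
                   (fg_core (Gs (Suc i)) (\<Lambda> (Suc i)) (P (Suc i)) (S (Suc i)) (R (Suc i)))) \<and>
    G \<cong> direct_limit (\<lambda>i. fg_core (Gs i) (\<Lambda> i) (P i) (S i) (R i)) \<phi>'"
proof -
  note grp = assms(2) and hom = assms(3)
  interpret seq: group_sequence Gs \<phi> using grp hom by (rule group_sequence.intro)
  note pgrp = plain_group.intro[OF grp]
  have sub: "\<And>l. l \<in> \<Lambda> i \<Longrightarrow> subgroup (P i l) (Gs i)" for i using assms(6) by blast
  define pres where "pres i \<equiv> finite_rel_presentation (Gs i) (\<Lambda> i) (P i)" for i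
  define gens where "gens i \<equiv> core_gens (Gs i) (\<Lambda> i) (P i)" for i
  define e where "e i = from_nat_into (carrier (Gs i))" for i
  \<comment> \<open>For \<open>x = e j k\<close>, the image of \<open>x\<close> in the \<open>i\<close>-th group lies in \<open>T i\<close> as soon as \<open>i\<close> is at least
    \<open>max j k\<close>, although each \<open>T i\<close> is finite.\<close>
  define T where "T i = (\<lambda>(j, k). push \<phi> j (e j k) (i - j)) ` ({..i} \<times> {..i})" for i
  have nonempty: "carrier (Gs i) \<noteq> {}" for i
    using monoid.one_closed[OF group.is_monoid[OF grp]] by blast
  have e_in: "e i k \<in> carrier (Gs i)" for i k
    using from_nat_into[OF nonempty] by (simp add: e_def)
  have e_onto: "\<exists>k. x = e i k" if "x \<in> carrier (Gs i)" for i x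
    using from_nat_into_surj[OF assms(5) that] by (auto simp: e_def)
  have T: "finite (T i)" "T i \<subseteq> carrier (Gs i)" for i
  proof -
    show "finite (T i)" by (simp add: T_def)
    have "push \<phi> j (e j k) (i - j) \<in> carrier (Gs i)" if "j \<le> i" for j k
      using seq.push_closed[OF e_in, of j k "i - j"] that by simp
    then show "T i \<subseteq> carrier (Gs i)" by (auto simp: T_def)
  qed
  have enlarge: "\<exists>S R. pres i S R \<and> U \<subseteq> S" if U: "finite U" "U \<subseteq> carrier (Gs i)" for i U
  proof -
    obtain S R where "pres i S R"
      using assms(7)[of i] unfolding rel_hyperbolic_def pres_def by blast
    then have "\<exists>R'. pres i (U \<union> S) R'"
      unfolding pres_def
      by (rule plain_group.finite_rel_presentation_add_generators[OF pgrp _ sub U])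
    then obtain R' where "pres i (U \<union> S) R'" by blast
    then show ?thesis by (intro exI[of _ "U \<union> S"]) auto
  qed
  have gens: "finite (gens i S R)" "gens i S R \<subseteq> carrier (Gs i)" if "pres i S R" for i S R
  proof -
    have S: "finite S" "finite R" "S \<subseteq> carrier (Gs i)"
      using that by (auto simp: pres_def finite_rel_presentation_def)
    show "finite (gens i S R)" unfolding gens_def by (rule finite_core_gens[OF S(1,2)])
    show "gens i S R \<subseteq> carrier (Gs i)"
      unfolding gens_def by (rule plain_group.core_gens_subset[OF pgrp S(3) sub])
  qed
  have "\<exists>SR. \<forall>i. (pres i (fst (SR i)) (snd (SR i)) \<and> T i \<subseteq> fst (SR i)) \<and>
      \<phi> i ` gens i (fst (SR i)) (snd (SR i)) \<subseteq> fst (SR (Suc i))"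
  proof -
    have "\<exists>SR. (pres 0 (fst SR) (snd SR) \<and> T 0 \<subseteq> fst SR)"
      using enlarge[OF T] by auto
    moreover have "\<exists>SR'. (pres (Suc i) (fst SR') (snd SR') \<and> T (Suc i) \<subseteq> fst SR') \<and>
        \<phi> i ` gens i (fst SR) (snd SR) \<subseteq> fst SR'"
      if "pres i (fst SR) (snd SR) \<and> T i \<subseteq> fst SR" for i SR
    proof -
      have "finite (T (Suc i) \<union> \<phi> i ` gens i (fst SR) (snd SR))"
        "T (Suc i) \<union> \<phi> i ` gens i (fst SR) (snd SR) \<subseteq> carrier (Gs (Suc i))"
        using that gens T hom_in_carrier[OF hom] by blast+
      from enlarge[OF this] show ?thesis by auto
    qed
    ultimately show ?thesis
      using dependent_nat_choice
        [of "\<lambda>i SR. pres i (fst SR) (snd SR) \<and> T i \<subseteq> fst SR"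
            "\<lambda>i SR SR'. \<phi> i ` gens i (fst SR) (snd SR) \<subseteq> fst SR'"] by metis
  qed
  then obtain SR where SR: "\<And>i. pres i (fst (SR i)) (snd (SR i))" "\<And>i. T i \<subseteq> fst (SR i)"
    "\<And>i. \<phi> i ` gens i (fst (SR i)) (snd (SR i)) \<subseteq> fst (SR (Suc i))"
    by blast
  define S where "S i = fst (SR i)" for i
  define R where "R i = snd (SR i)" for i
  define A where "A i = gens i (S i) (R i)" for i
  define K where "K i = generate (Gs i) (A i)" for i
  have pres: "pres i (S i) (R i)" for i using SR by (simp add: S_def R_def)
  have A: "finite (A i)" "A i \<subseteq> carrier (Gs i)" for i using gens[OF pres] by (auto simp: A_def)
  have SA: "S i \<subseteq> A i" for i by (auto simp: A_def gens_def core_gens_def)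
  have AK: "A i \<subseteq> K i" for i by (auto simp: K_def intro: generate.incl)
  have core: "fg_core (Gs i) (\<Lambda> i) (P i) (S i) (R i) = (Gs i)\<lparr>carrier := K i\<rparr>" for i
  proof -
    have "S i \<subseteq> carrier (Gs i)" using SA A by blast
    then show ?thesis
      unfolding K_def A_def gens_def by (rule plain_group.fg_core_eq[OF pgrp _ sub])
  qed
  have subK: "subgroup (K i) (Gs i)" for i
    unfolding K_def by (rule group.generate_is_subgroup[OF grp A(2)])
  have maps: "\<phi> i ` K i \<subseteq> K (Suc i)" for i
  proof -
    interpret group_hom "Gs i" "Gs (Suc i)" "\<phi> i"
      using grp hom by (simp add: group_hom_def group_hom_axioms_def)
    have "\<phi> i ` K i = generate (Gs (Suc i)) (\<phi> i ` A i)"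
      unfolding K_def using generate_img[OF A(2)] by simp
    also have "\<dots> \<subseteq> K (Suc i)"
      unfolding K_def using SR(3)[of i] SA[of "Suc i"]
      by (intro group.mono_generate[OF grp]) (auto simp: A_def S_def R_def)
    finally show ?thesis .
  qed
  have absorb: "\<exists>N. \<forall>i\<ge>N. g i \<in> K i" if g: "g \<in> limit_seqs Gs \<phi>" for g
  proof -
    obtain J where J: "\<forall>j\<ge>J. g (Suc j) = \<phi> j (g j)" and "g J \<in> carrier (Gs J)"
      using g by (auto simp: limit_seqs_iff)
    then obtain k where k: "g J = e J k" using e_onto by blast
    have "g i \<in> K i" if "i \<ge> max J k" for i
    proof -
      have "g i = push \<phi> J (e J k) (i - J)"
        using eventually_push[where g = g and \<phi> = \<phi>, OF J, of "i - J"] that k by simp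
      then have "g i \<in> T i" using that unfolding T_def by force
      then show ?thesis using SR(2)[of i] SA[of i] AK[of i] by (auto simp: S_def)
    qed
    then show ?thesis by blast
  qed
  have "G \<cong> direct_limit (\<lambda>i. (Gs i)\<lparr>carrier := K i\<rparr>) \<phi>"
    using assms(4) seq.direct_limit_subgroups_iso[OF subK maps absorb] by (rule iso_trans)
  moreover have "finitely_generated ((Gs i)\<lparr>carrier := K i\<rparr>)" for i
    unfolding finitely_generated_def
    using A AK group.generate_consistent[OF grp AK subK] by (intro exI[of _ "A i"]) (simp add: K_def)
  moreover have "\<phi> i \<in> hom ((Gs i)\<lparr>carrier := K i\<rparr>) ((Gs (Suc i))\<lparr>carrier := K (Suc i)\<rparr>)" for i
    by (rule hom_subgroups[OF hom subK maps])
  ultimately show ?thesis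
    using pres unfolding pres_def
    by (intro exI[of _ S] exI[of _ R] exI[of _ \<phi>]) (simp add: core)
qed

end
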